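(* Assume that $\Phi$ has a unique minimizer $\theta^*$ on $\Theta$. Let $(\hat\theta_n)_{n\ge 1}$ be a sequence of random variables with values in $\Theta$ such that, with probability $1$, $\hat\theta_n$ is a minimizer of $\Phi_n$ on $\Theta$ for all large enough $n$. Assume that $\phi(\cdot,\theta)\in L^2(P)$ for all $\theta\in\Theta_0$ and that $0\in\mathrm{int}(\partial\Phi(\theta^* ))$. Then $\mathbb P(\hat\theta_n=\theta^* )\to1$ as $n\to\infty$.
   Context: All random variables are defined on a fixed probability space $(\Omega,\mathcal F,\mathbb P)$. $X_1,X_2,\ldots$ are iid random variables with values in a measurable space $E$, with distribution $P$. $\Theta_0\subseteq\mathbb R^d$ is a fixed open convex set and $\Theta$ is a closed convex subset of $\Theta_0$. The loss $\phi:E\times\Theta_0\to\mathbb R$ is measurable in its first argument, convex in its second argument, and $\phi(\cdot,\theta)\in L^1(P)$ for all $\theta\in\Theta_0$. For $\theta\in\Theta_0$ and $n\ge1$, $\Phi(\theta)=\mathbb E[\phi(X_1,\theta)]$ and $\Phi_n(\theta)=\frac1n\sum_{i=1}^n\phi(X_i,\theta)$. $\partial\Phi(\theta^* )$ is the set of all subgradients of $\Phi$ at $\theta^*$, i.e. all $u\in\mathbb R^d$ with $\Phi(\theta)\ge\Phi(\theta^* )+u^\top(\theta-\theta^* )$ for all $\theta\in\Theta_0$. $\mathrm{int}$ denotes the interior in $\mathbb R^d$. *)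

theory Defs
  imports "HOL-Probability.Probability"
begin

definition subdifferential :: "'v::real_inner set \<Rightarrow> ('v \<Rightarrow> real) \<Rightarrow> 'v \<Rightarrow> 'v set" where
  "subdifferential S f x = {u. \<forall>y\<in>S. f y \<ge> f x + u \<bullet> (y - x)}"

definition population_risk ::
  "'w measure \<Rightarrow> (nat \<Rightarrow> 'w \<Rightarrow> 'e) \<Rightarrow> ('e \<Rightarrow> 'v \<Rightarrow> real) \<Rightarrow> 'v \<Rightarrow> real" where
  "population_risk M X \<phi> \<theta> = (\<integral>\<omega>. \<phi> (X 1 \<omega>) \<theta> \<partial>M)"

(* The sample is X 1, X 2, ...; the value X 0 is never used. *)
definition empirical_risk ::
  "(nat \<Rightarrow> 'w \<Rightarrow> 'e) \<Rightarrow> ('e \<Rightarrow> 'v \<Rightarrow> real) \<Rightarrow> nat \<Rightarrow> 'w \<Rightarrow> 'v \<Rightarrow> real" where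
  "empirical_risk X \<phi> n \<omega> \<theta> = (1 / real n) * (\<Sum>i=1..n. \<phi> (X i \<omega>) \<theta>)"

end

theory Submission
  imports Defs "HOL-Real_Asymp.Real_Asymp"
begin

text \<open>That zero is interior to the subdifferential makes \<open>\<Phi>\<close> sharp at \<open>\<theta>\<^sup>*\<close>: its
directional derivative \<open>\<Phi>'(\<theta>\<^sup>*; u)\<close> is at least \<open>c \<parallel>u\<parallel>\<close> for some \<open>c > 0\<close>
(\<open>dir_deriv_linear_growth\<close>). This strict lower bound on first-order growth survives, with high
probability, the replacement of \<open>\<Phi>\<close> by \<open>\<Phi>\<^sub>n\<close>, and by convexity
a function that is sharp at \<open>\<theta>\<^sup>*\<close> has no other minimizer. This is why the estimator does not merely approach \<open>\<theta>\<^sup>*\<close> but hits it exactly.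

To make this precise, let \<open>D u x\<close> be the directional derivative of \<open>\<phi>(x, \<cdot>)\<close> at \<open>\<theta>\<^sup>*\<close> along \<open>u\<close>.
Convexity gives \<open>\<phi>(x, \<theta>) - \<phi>(x, \<theta>\<^sup>*) \<ge> D (\<theta> - \<theta>\<^sup>*) x\<close>, so, with \<open>G\<^sub>n u\<close> the average of \<open>D u\<close>
over the sample, \<open>\<Phi>\<^sub>n \<theta> - \<Phi>\<^sub>n \<theta>\<^sup>* \<ge> G\<^sub>n (\<theta> - \<theta>\<^sup>*)\<close>. It therefore suffices that \<open>G\<^sub>n u > 0\<close> for all
\<open>u \<noteq> 0\<close> simultaneously, with probability tending to one. For one fixed \<open>u\<close>, \<open>D u\<close> is square
integrable and has mean \<open>\<Phi>'(\<theta>\<^sup>*; u)\<close> (\<open>square_integrable_dir_deriv\<close>, \<open>expectation_dir_deriv\<close>), so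
the weak law of large numbers applies. The passage to all \<open>u\<close> uses that \<open>G\<^sub>n\<close> is sublinear: bounds
at finitely many points, namely a fine net of the unit sphere and the vectors of a basis with their
negatives, already force a sublinear function to be positive away from zero
(\<open>sublinear_positive_net\<close>).\<close>

section \<open>One-sided directional derivatives of convex functions\<close>

definition slope :: "('v::real_vector \<Rightarrow> real) \<Rightarrow> 'v \<Rightarrow> 'v \<Rightarrow> real \<Rightarrow> real" where
  "slope f x u t = (f (x + t *\<^sub>R u) - f x) / t"

definition steps :: "'v::real_vector set \<Rightarrow> 'v \<Rightarrow> 'v \<Rightarrow> real set" where
  "steps S x u = {t. 0 < t \<and> x + t *\<^sub>R u \<in> S}"

text \<open>Slopes of a convex function increase with the step, so their limit as the step tends to zero is
their infimum. Taking the infimum as the definition makes the derivative a lower bound for every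
slope and leaves the limit (\<open>tendsto_slope_dir_deriv\<close>) as a consequence.\<close>

definition dir_deriv :: "'v::real_vector set \<Rightarrow> ('v \<Rightarrow> real) \<Rightarrow> 'v \<Rightarrow> 'v \<Rightarrow> real" where
  "dir_deriv S f x u = (INF t\<in>steps S x u. slope f x u t)"

text \<open>Positive homogeneity is required for positive factors; with factor 2 it also forces \<open>g 0 = 0\<close>.\<close>

definition sublinear :: "('v::real_vector \<Rightarrow> real) \<Rightarrow> bool" where
  "sublinear g \<longleftrightarrow> (\<forall>u v. g (u + v) \<le> g u + g v) \<and> (\<forall>c>0. \<forall>u. g (c *\<^sub>R u) = c * g u)"

lemma eventually_steps:
  fixes S :: "'v::real_normed_vector set"
  assumes "open S" "x \<in> S"
  shows "\<forall>\<^sub>F t in at_right 0. t \<in> steps S x u"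
proof -
  have "((\<lambda>t. x + t *\<^sub>R u) \<longlongrightarrow> x + 0 *\<^sub>R u) (at_right 0)"
    by (intro tendsto_intros)
  then have "\<forall>\<^sub>F t in at_right 0. x + t *\<^sub>R u \<in> S"
    using assms topological_tendstoD by fastforce
  moreover have "\<forall>\<^sub>F t::real in at_right 0. 0 < t"
    by (rule eventually_at_right_less)
  ultimately show ?thesis
    by eventually_elim (simp add: steps_def)
qed

lemma obtain_common_step:
  fixes S :: "'v::real_normed_vector set"
  assumes "open S" "x \<in> S"
  obtains s where "s \<in> steps S x u" "s \<in> steps S x v"
proof -
  have "\<forall>\<^sub>F t in at_right (0::real). t \<in> steps S x u \<and> t \<in> steps S x v"
    using eventually_steps[OF assms] by (intro eventually_conj) auto
  then show ?thesis
    using that eventually_happens'[OF trivial_limit_at_right_real] by blast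
qed

lemma steps_downward:
  assumes "convex S" "x \<in> S" "s \<in> steps S x u" "0 < t" "t \<le> s"
  shows "t \<in> steps S x u"
proof -
  have s: "0 < s" "x + s *\<^sub>R u \<in> S"
    using assms by (auto simp: steps_def)
  have "(1 - t / s) *\<^sub>R x + (t / s) *\<^sub>R (x + s *\<^sub>R u) \<in> S"
    using assms s by (intro convexD_alt) auto
  also have "(1 - t / s) *\<^sub>R x + (t / s) *\<^sub>R (x + s *\<^sub>R u) = x + t *\<^sub>R u"
    using s by (simp add: algebra_simps)
  finally show ?thesis using assms by (simp add: steps_def)
qed

lemma slope_mono:
  assumes "convex_on S f" "x \<in> S" "s \<in> steps S x u" "0 < t" "t \<le> s"
  shows "slope f x u t \<le> slope f x u s"
proof -
  have s: "0 < s" "x + s *\<^sub>R u \<in> S"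
    using assms by (auto simp: steps_def)
  have "f ((1 - t / s) *\<^sub>R x + (t / s) *\<^sub>R (x + s *\<^sub>R u))
        \<le> (1 - t / s) * f x + (t / s) * f (x + s *\<^sub>R u)"
    using assms s by (intro convex_onD) auto
  also have "(1 - t / s) *\<^sub>R x + (t / s) *\<^sub>R (x + s *\<^sub>R u) = x + t *\<^sub>R u"
    using s by (simp add: algebra_simps)
  finally have "f (x + t *\<^sub>R u) - f x \<le> t * slope f x u s"
    by (simp add: slope_def algebra_simps diff_divide_distrib)
  then show ?thesis
    using assms by (simp add: slope_def divide_le_eq mult.commute)
qed

text \<open>The base point lies between the point reached by a step along \<open>u\<close> and the one reached by a step
along \<open>- u\<close>. This bounds the slopes along \<open>u\<close> from below, which makes the infimum meaningful, and
later provides an integrable minorant.\<close>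

lemma slope_opposite:
  assumes "convex_on S f" "s \<in> steps S x (- u)" "t \<in> steps S x u"
  shows "- slope f x (- u) s \<le> slope f x u t"
proof -
  have s: "0 < s" "x - s *\<^sub>R u \<in> S" and t: "0 < t" "x + t *\<^sub>R u \<in> S"
    using assms by (auto simp: steps_def)
  have "f ((1 - t / (s + t)) *\<^sub>R (x + t *\<^sub>R u) + (t / (s + t)) *\<^sub>R (x - s *\<^sub>R u))
        \<le> (1 - t / (s + t)) * f (x + t *\<^sub>R u) + (t / (s + t)) * f (x - s *\<^sub>R u)"
    using assms s t by (intro convex_onD) auto
  also have "(1 - t / (s + t)) *\<^sub>R (x + t *\<^sub>R u) + (t / (s + t)) *\<^sub>R (x - s *\<^sub>R u) = x"
  proof -
    have "(1 - t / (s + t)) * t - (t / (s + t)) * s = 0"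
      using s t by (simp add: field_simps)
    moreover have "(1 - t / (s + t)) *\<^sub>R (x + t *\<^sub>R u) + (t / (s + t)) *\<^sub>R (x - s *\<^sub>R u)
        = x + ((1 - t / (s + t)) * t - (t / (s + t)) * s) *\<^sub>R u"
      by (simp add: algebra_simps)
    ultimately show ?thesis by simp
  qed
  also have "1 - t / (s + t) = s / (s + t)"
    using s t by (simp add: field_simps)
  finally have "f x \<le> (s * f (x + t *\<^sub>R u) + t * f (x - s *\<^sub>R u)) / (s + t)"
    by (simp add: add_divide_distrib)
  then have "(s + t) * f x \<le> s * f (x + t *\<^sub>R u) + t * f (x - s *\<^sub>R u)"
    using s t by (simp add: pos_le_divide_eq mult.commute)
  then show ?thesis
    using s t by (simp add: slope_def field_simps)
qed

lemma bdd_below_slope: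
  fixes S :: "'v::real_normed_vector set"
  assumes "convex_on S f" "open S" "x \<in> S"
  shows "bdd_below (slope f x u ` steps S x u)"
proof -
  obtain s where "s \<in> steps S x (- u)"
    using obtain_common_step[OF assms(2,3)] .
  then show ?thesis
    using slope_opposite[OF assms(1)] by (intro bdd_belowI2) blast
qed

lemma dir_deriv_le_slope:
  fixes S :: "'v::real_normed_vector set"
  assumes "convex_on S f" "open S" "x \<in> S" "t \<in> steps S x u"
  shows "dir_deriv S f x u \<le> slope f x u t"
  unfolding dir_deriv_def using assms by (intro cINF_lower bdd_below_slope)

lemma dir_deriv_greatest:
  fixes S :: "'v::real_normed_vector set"
  assumes "open S" "x \<in> S" "\<And>t. t \<in> steps S x u \<Longrightarrow> m \<le> slope f x u t"
  shows "m \<le> dir_deriv S f x u"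
  unfolding dir_deriv_def
  using obtain_common_step[OF assms(1,2)] assms(3) by (intro cINF_greatest) blast+

text \<open>The increment is the slope at step 1 along \<open>y - x\<close>.\<close>

lemma dir_deriv_le_increment:
  fixes S :: "'v::real_normed_vector set"
  assumes "convex_on S f" "open S" "x \<in> S" "y \<in> S"
  shows "dir_deriv S f x (y - x) \<le> f y - f x"
  using dir_deriv_le_slope[OF assms(1-3), of 1 "y - x"] assms(4)
  by (simp add: steps_def slope_def)

text \<open>A step \<open>t / 2\<close> along \<open>u + v\<close> ends at the midpoint of the steps \<open>t\<close> along \<open>u\<close> and along \<open>v\<close>. So
convexity bounds a slope along \<open>u + v\<close> by the sum of two slopes, and monotonicity of slopes allows
the two to be enlarged to independent steps before the infima are taken.\<close>

lemma dir_deriv_subadditive: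
  fixes S :: "'v::real_normed_vector set"
  assumes "convex_on S f" "open S" "x \<in> S"
  shows "dir_deriv S f x (u + v) \<le> dir_deriv S f x u + dir_deriv S f x v"
proof -
  have S: "convex S" using assms(1) by (simp add: convex_on_def)
  have *: "dir_deriv S f x (u + v) \<le> slope f x u a + slope f x v b"
    if a: "a \<in> steps S x u" and b: "b \<in> steps S x v" for a b
  proof -
    define t where "t = min a b"
    have t: "0 < t" "t \<le> a" "t \<le> b"
      using a b by (auto simp: t_def steps_def)
    have tu: "x + t *\<^sub>R u \<in> S" and tv: "x + t *\<^sub>R v \<in> S"
      using steps_downward[OF S assms(3) a] steps_downward[OF S assms(3) b] t
      by (auto simp: steps_def)
    have mid: "(1 - 1/2) *\<^sub>R (x + t *\<^sub>R u) + (1/2) *\<^sub>R (x + t *\<^sub>R v) = x + (t / 2) *\<^sub>R (u + v)"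
      by (simp add: algebra_simps flip: scaleR_add_left)
    have "x + (t / 2) *\<^sub>R (u + v) \<in> S"
      using convexD_alt[OF S tu tv, of "1/2"] unfolding mid by simp
    then have "dir_deriv S f x (u + v) \<le> slope f x (u + v) (t / 2)"
      using t by (intro dir_deriv_le_slope assms) (auto simp: steps_def)
    also have "\<dots> \<le> slope f x u t + slope f x v t"
    proof -
      have "2 * f (x + (t / 2) *\<^sub>R (u + v)) \<le> f (x + t *\<^sub>R u) + f (x + t *\<^sub>R v)"
        using convex_onD[OF assms(1), of "1/2", OF _ _ tu tv] unfolding mid by simp
      then have "2 * (f (x + (t / 2) *\<^sub>R (u + v)) - f x) / t
          \<le> (f (x + t *\<^sub>R u) - f x + (f (x + t *\<^sub>R v) - f x)) / t"
        using t(1) by (intro divide_right_mono) auto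
      moreover have "slope f x (u + v) (t / 2) = 2 * (f (x + (t / 2) *\<^sub>R (u + v)) - f x) / t"
        by (simp add: slope_def)
      ultimately show ?thesis by (simp only: slope_def add_divide_distrib)
    qed
    also have "\<dots> \<le> slope f x u a + slope f x v b"
      using slope_mono[OF assms(1,3) a] slope_mono[OF assms(1,3) b] t by (intro add_mono) auto
    finally show ?thesis .
  qed
  have "dir_deriv S f x (u + v) - slope f x u a \<le> dir_deriv S f x v"
    if "a \<in> steps S x u" for a
    using *[OF that] by (intro dir_deriv_greatest assms) (simp add: algebra_simps)
  then have "dir_deriv S f x (u + v) - dir_deriv S f x v \<le> dir_deriv S f x u"
    by (intro dir_deriv_greatest assms) (simp add: algebra_simps)
  then show ?thesis by simp
qed

lemma dir_deriv_scale:
  fixes S :: "'v::real_normed_vector set"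
  assumes "convex_on S f" "open S" "x \<in> S" "0 < c"
  shows "dir_deriv S f x (c *\<^sub>R u) = c * dir_deriv S f x u"
proof -
  have *: "d * dir_deriv S f x w \<le> dir_deriv S f x (d *\<^sub>R w)" if d: "0 < d" for d w
  proof (intro dir_deriv_greatest assms)
    fix t assume "t \<in> steps S x (d *\<^sub>R w)"
    then have "t * d \<in> steps S x w" "0 < t"
      using d by (auto simp: steps_def)
    with dir_deriv_le_slope[OF assms(1-3)] have "dir_deriv S f x w \<le> slope f x w (t * d)" by blast
    with d \<open>0 < t\<close> show "d * dir_deriv S f x w \<le> slope f x (d *\<^sub>R w) t"
      by (simp add: slope_def field_simps)
  qed
  have "inverse c * dir_deriv S f x (c *\<^sub>R u) \<le> dir_deriv S f x u"
    using *[of "inverse c" "c *\<^sub>R u"] assms(4) by simp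
  then have "dir_deriv S f x (c *\<^sub>R u) \<le> c * dir_deriv S f x u"
    using assms(4) by (simp add: field_simps)
  with *[OF assms(4)] show ?thesis by (intro antisym)
qed

lemma sublinear_dir_deriv:
  fixes S :: "'v::real_normed_vector set"
  assumes "convex_on S f" "open S" "x \<in> S"
  shows "sublinear (dir_deriv S f x)"
  using dir_deriv_subadditive[OF assms] dir_deriv_scale[OF assms] by (simp add: sublinear_def)

lemma tendsto_slope_dir_deriv:
  fixes S :: "'v::real_normed_vector set"
  assumes "convex_on S f" "open S" "x \<in> S"
  shows "(slope f x u \<longlongrightarrow> dir_deriv S f x u) (at_right 0)"
proof (rule order_tendstoI)
  fix a assume "a < dir_deriv S f x u"
  with eventually_steps[OF assms(2,3), of u] show "\<forall>\<^sub>F t in at_right 0. a < slope f x u t"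
    by (auto elim!: eventually_mono intro: less_le_trans dir_deriv_le_slope[OF assms])
next
  fix a assume "dir_deriv S f x u < a"
  then obtain s where s: "s \<in> steps S x u" "slope f x u s < a"
    using dir_deriv_greatest[OF assms(2,3), of u a f] by (meson not_le)
  then have "0 < s" by (simp add: steps_def)
  then have "\<forall>\<^sub>F t in at_right 0. t < s \<and> 0 < t"
    by (auto simp: eventually_at_right intro: exI[of _ s])
  then show "\<forall>\<^sub>F t in at_right 0. slope f x u t < a"
  proof eventually_elim
    case (elim t)
    then show ?case
      using slope_mono[OF assms(1,3) s(1), of t] s(2) by auto
  qed
qed

lemma dir_deriv_ge_subgradient:
  fixes S :: "'v::real_inner set"
  assumes "open S" "x \<in> S" "w \<in> subdifferential S f x"
  shows "w \<bullet> u \<le> dir_deriv S f x u"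
proof (intro dir_deriv_greatest assms)
  fix t assume "t \<in> steps S x u"
  then have "0 < t" "f x + w \<bullet> (t *\<^sub>R u) \<le> f (x + t *\<^sub>R u)"
    using assms(3) by (auto simp: steps_def subdifferential_def)
  then show "w \<bullet> u \<le> slope f x u t"
    by (simp add: slope_def field_simps)
qed

text \<open>If the ball of radius \<open>c\<close> consists of subgradients, then so does in particular the multiple of \<open>u\<close>
with norm \<open>c\<close>, and its inner product with \<open>u\<close> is \<open>c * norm u\<close>.\<close>

lemma dir_deriv_linear_growth:
  fixes S :: "'v::real_inner set"
  assumes "open S" "x \<in> S" "0 \<in> interior (subdifferential S f x)"
  obtains c where "0 < c" "\<And>u. c * norm u \<le> dir_deriv S f x u"
proof -
  obtain c where c: "0 < c" "cball 0 c \<subseteq> subdifferential S f x"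
    using assms(3) by (auto simp: mem_interior_cball)
  have "c * norm u \<le> dir_deriv S f x u" for u
  proof -
    have "(c / norm u) *\<^sub>R u \<in> subdifferential S f x"
      using c by (intro subsetD[OF c(2)]) (cases "u = 0", auto)
    from dir_deriv_ge_subgradient[OF assms(1,2) this, of u] show ?thesis
      by (cases "u = 0") (auto simp: power2_eq_square dot_square_norm)
  qed
  with c(1) that show ?thesis by blast
qed

section \<open>Positivity of sublinear functions from finitely many values\<close>

lemma sublinear_zero: "sublinear g \<Longrightarrow> g 0 = 0"
  unfolding sublinear_def by (metis add_cancel_right_right mult_2 scaleR_zero_right zero_less_numeral)

lemma sublinear_sum:
  assumes "sublinear g" "finite A"
  shows "g (\<Sum>i\<in>A. h i) \<le> (\<Sum>i\<in>A. g (h i))"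
  using assms(2)
proof induction
  case empty
  then show ?case using sublinear_zero[OF assms(1)] by simp
next
  case (insert i A)
  then show ?case
    using assms(1) unfolding sublinear_def by (smt (verit) sum.insert)
qed

text \<open>Expanding \<open>w\<close> in the basis, each term is a nonnegative multiple of \<open>b\<close> or of \<open>- b\<close>. This gives a
one-sided Lipschitz bound for \<open>g\<close> from its values at finitely many vectors.\<close>

lemma sublinear_bound:
  fixes g :: "'v::euclidean_space \<Rightarrow> real"
  assumes g: "sublinear g" and C: "0 \<le> C"
    and b: "\<And>b. b \<in> Basis \<Longrightarrow> g b \<le> C \<and> g (- b) \<le> C"
  shows "g w \<le> C * DIM('v) * norm w"
proof -
  have "g ((w \<bullet> b) *\<^sub>R b) \<le> C * norm w" if "b \<in> Basis" for b
  proof -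
    have "g ((w \<bullet> b) *\<^sub>R b) \<le> \<bar>w \<bullet> b\<bar> * C"
    proof (cases "w \<bullet> b" "0::real" rule: linorder_cases)
      case less
      then have "g ((- (w \<bullet> b)) *\<^sub>R (- b)) = (- (w \<bullet> b)) * g (- b)"
        using g unfolding sublinear_def by (metis neg_0_less_iff_less)
      also have "\<dots> \<le> (- (w \<bullet> b)) * C"
        using less b[OF that] by (intro mult_left_mono) auto
      finally show ?thesis using less by simp
    next
      case equal
      then show ?thesis using sublinear_zero[OF g] by simp
    next
      case greater
      then have "g ((w \<bullet> b) *\<^sub>R b) = (w \<bullet> b) * g b"
        using g unfolding sublinear_def by blast
      also have "\<dots> \<le> (w \<bullet> b) * C"
        using greater b[OF that] by (intro mult_left_mono) auto
      finally show ?thesis using greater by simp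
    qed
    also have "\<dots> \<le> norm w * C"
      using Basis_le_norm[OF that] C by (intro mult_right_mono) auto
    finally show ?thesis by (simp add: mult.commute)
  qed
  then have "(\<Sum>b\<in>Basis. g ((w \<bullet> b) *\<^sub>R b)) \<le> (\<Sum>b\<in>(Basis::'v set). C * norm w)"
    by (rule sum_mono)
  with sublinear_sum[OF g finite_Basis, of "\<lambda>b. (w \<bullet> b) *\<^sub>R b"] show ?thesis
    by (simp add: euclidean_representation algebra_simps)
qed

text \<open>The net depends on \<open>c\<close> and \<open>C\<close> only, so that one net serves all functions \<open>g\<close>, and in the
application all samples. A unit vector \<open>w\<close> is within \<open>\<delta>\<close> of a net point \<open>v\<close>, and
\<open>g v \<le> g w + g (v - w)\<close>, where the last term is at most a multiple of \<open>\<delta>\<close> by \<open>sublinear_bound\<close>;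
homogeneity reduces other vectors to unit vectors.\<close>

lemma sublinear_positive_net:
  fixes c C :: real
  assumes "0 < c" "0 \<le> C"
  obtains V :: "'v::euclidean_space set" where "finite V" "V \<subseteq> sphere 0 1"
    "\<And>g u. sublinear g \<Longrightarrow> (\<And>v. v \<in> V \<Longrightarrow> c \<le> g v)
      \<Longrightarrow> (\<And>b. b \<in> Basis \<Longrightarrow> g b \<le> C \<and> g (- b) \<le> C) \<Longrightarrow> u \<noteq> 0 \<Longrightarrow> 0 < g u"
proof -
  define L where "L = C * DIM('v)"
  \<comment> \<open>The \<open>+ 1\<close> covers \<open>L = 0\<close> and makes \<open>L * \<delta> < c\<close> strict.\<close>
  define \<delta> where "\<delta> = c / (L + 1)"
  have L: "0 \<le> L" using assms by (simp add: L_def)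
  then have \<delta>: "0 < \<delta>" "L * \<delta> < c"
    using assms by (auto simp: \<delta>_def field_simps)
  obtain V where V: "finite V" "V \<subseteq> sphere (0::'v) 1" "sphere 0 1 \<subseteq> (\<Union>v\<in>V. ball v \<delta>)"
    using seq_compact_imp_totally_bounded[of "sphere (0::'v) 1"] \<delta>(1)
    by (metis compact_sphere compact_imp_seq_compact)
  have "0 < g u" if g: "sublinear g" and gV: "\<And>v. v \<in> V \<Longrightarrow> c \<le> g v"
    and gB: "\<And>b. b \<in> Basis \<Longrightarrow> g b \<le> C \<and> g (- b) \<le> C" and u: "u \<noteq> 0" for g u
  proof -
    define w where "w = (1 / norm u) *\<^sub>R u"
    have "w \<in> sphere 0 1" using u by (simp add: w_def)
    then obtain v where v: "v \<in> V" "norm (v - w) < \<delta>"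
      using V(3) by (auto simp: dist_norm)
    have "c \<le> g v" by (rule gV[OF v(1)])
    also have "g v \<le> g w + g (v - w)"
      using g unfolding sublinear_def by (metis add_diff_cancel_left' diff_add_cancel add.commute)
    also have "g (v - w) \<le> L * norm (v - w)"
      using sublinear_bound[OF g assms(2) gB] by (simp add: L_def)
    also have "\<dots> \<le> L * \<delta>"
      using v(2) L by (intro mult_left_mono) auto
    finally have "0 < g w" using \<delta>(2) by simp
    moreover have "g w = (1 / norm u) * g u"
      using g u unfolding sublinear_def w_def by simp
    ultimately show ?thesis
      using u by (simp add: zero_less_divide_iff)
  qed
  with V that show ?thesis by blast
qed

section \<open>A weak law of large numbers\<close>

lemma integrable_square_add:
  fixes f g :: "'a \<Rightarrow> real"
  assumes [measurable]: "f \<in> borel_measurable M" "g \<in> borel_measurable M"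
    and "integrable M (\<lambda>x. (f x)\<^sup>2)" "integrable M (\<lambda>x. (g x)\<^sup>2)"
  shows "integrable M (\<lambda>x. (f x + g x)\<^sup>2)"
proof (rule Bochner_Integration.integrable_bound)
  show "integrable M (\<lambda>x. 2 * (f x)\<^sup>2 + 2 * (g x)\<^sup>2)"
    using assms by auto
  have "(f x + g x)\<^sup>2 \<le> 2 * (f x)\<^sup>2 + 2 * (g x)\<^sup>2" for x
    using sum_squares_bound[of "f x" "g x"] by (simp add: power2_sum)
  then show "AE x in M. norm ((f x + g x)\<^sup>2) \<le> norm (2 * (f x)\<^sup>2 + 2 * (g x)\<^sup>2)"
    by (auto intro: order_trans[OF _ abs_ge_self])
qed simp

text \<open>Expanding the square when one summand is split off, the mixed term has mean zero because that
summand is independent of the sum of the others.\<close>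

lemma (in prob_space) expectation_square_sum_indep:
  fixes Z :: "'i \<Rightarrow> 'a \<Rightarrow> real"
  assumes "finite I" "indep_vars (\<lambda>_. borel) Z I"
    and "\<And>i. i \<in> I \<Longrightarrow> integrable M (\<lambda>\<omega>. (Z i \<omega>)\<^sup>2)"
    and "\<And>i. i \<in> I \<Longrightarrow> expectation (Z i) = 0"
  shows "integrable M (\<lambda>\<omega>. (\<Sum>i\<in>I. Z i \<omega>)\<^sup>2) \<and>
    expectation (\<lambda>\<omega>. (\<Sum>i\<in>I. Z i \<omega>)\<^sup>2) = (\<Sum>i\<in>I. expectation (\<lambda>\<omega>. (Z i \<omega>)\<^sup>2))"
  using assms
proof (induction I)
  case empty
  then show ?case by simp
next
  case (insert i I)
  define T where "T \<omega> = (\<Sum>j\<in>I. Z j \<omega>)" for \<omega>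
  have meas: "Z j \<in> borel_measurable M" if "j \<in> insert i I" for j
    using insert.prems(1) that by (auto simp: indep_vars_def)
  note [measurable] = meas[of i, simplified]
  have T_meas[measurable]: "T \<in> borel_measurable M"
    unfolding T_def using meas by (intro borel_measurable_sum) auto
  have IH: "integrable M (\<lambda>\<omega>. (T \<omega>)\<^sup>2)"
    "expectation (\<lambda>\<omega>. (T \<omega>)\<^sup>2) = (\<Sum>j\<in>I. expectation (\<lambda>\<omega>. (Z j \<omega>)\<^sup>2))"
    using insert.IH insert.prems indep_vars_subset[OF insert.prems(1), of I]
    unfolding T_def by auto
  have Zi2: "integrable M (\<lambda>\<omega>. (Z i \<omega>)\<^sup>2)" using insert.prems by auto
  have Zi: "integrable M (Z i)" and Ti: "integrable M T"
    by (auto intro: square_integrable_imp_integrable Zi2 IH(1))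
  have ind: "indep_var borel (Z i) borel T"
    unfolding T_def using insert by (intro indep_vars_sum) auto
  have prod: "integrable M (\<lambda>\<omega>. Z i \<omega> * T \<omega>)" "expectation (\<lambda>\<omega>. Z i \<omega> * T \<omega>) = 0"
    using indep_var_integrable[OF ind Zi Ti] indep_var_lebesgue_integral[OF ind Zi Ti]
      insert.prems(3)[of i] by auto
  have eq: "(\<Sum>j\<in>insert i I. Z j \<omega>)\<^sup>2 = (Z i \<omega>)\<^sup>2 + (T \<omega>)\<^sup>2 + 2 * (Z i \<omega> * T \<omega>)" for \<omega>
    using insert.hyps by (simp add: T_def power2_sum)
  show ?case
    unfolding eq using Zi2 IH prod insert.hyps by simp
qed

text \<open>The variance of the average of \<open>n\<close> terms is \<open>\<sigma> / n\<close>, so Chebyshev's inequality gives the bound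
\<open>\<sigma> / (n \<epsilon>\<^sup>2)\<close>.\<close>

lemma (in prob_space) weak_law_of_large_numbers:
  fixes Y :: "nat \<Rightarrow> 'a \<Rightarrow> real"
  assumes ind: "indep_vars (\<lambda>_. borel) Y {1..}"
    and sq: "\<And>i. i \<ge> 1 \<Longrightarrow> integrable M (\<lambda>\<omega>. (Y i \<omega>)\<^sup>2)"
    and mean: "\<And>i. i \<ge> 1 \<Longrightarrow> expectation (Y i) = \<mu>"
    and var: "\<And>i. i \<ge> 1 \<Longrightarrow> variance (Y i) = \<sigma>"
    and \<epsilon>: "0 < \<epsilon>"
  shows "(\<lambda>n. prob {\<omega>\<in>space M. \<epsilon> \<le> \<bar>(1 / real n) * (\<Sum>i=1..n. Y i \<omega>) - \<mu>\<bar>}) \<longlonglongrightarrow> 0"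
proof (rule tendsto_sandwich[OF _ _ tendsto_const])
  show "(\<lambda>n. (\<sigma> / \<epsilon>\<^sup>2) * (1 / real n)) \<longlonglongrightarrow> 0"
    using tendsto_mult_right_zero[OF lim_1_over_n] by fast
  have meas: "Y i \<in> borel_measurable M" if "i \<ge> 1" for i
    using ind that by (auto simp: indep_vars_def)
  have int: "integrable M (Y i)" if "i \<ge> 1" for i
    using square_integrable_imp_integrable meas sq that by blast
  have "prob {\<omega>\<in>space M. \<epsilon> \<le> \<bar>(1 / real n) * (\<Sum>i=1..n. Y i \<omega>) - \<mu>\<bar>}
        \<le> (\<sigma> / \<epsilon>\<^sup>2) * (1 / real n)" if n: "n \<ge> 1" for n
  proof -
    define Z where "Z i \<omega> = Y i \<omega> - \<mu>" for i \<omega>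
    define A where "A \<omega> = (1 / real n) * (\<Sum>i=1..n. Y i \<omega>)" for \<omega>
    have A_meas: "A \<in> borel_measurable M"
      unfolding A_def using meas by (intro borel_measurable_times borel_measurable_sum) auto
    have A_mean: "expectation A = \<mu>"
    proof -
      have "expectation A = (1 / real n) * (\<Sum>i=1..n. expectation (Y i))"
        unfolding A_def using int by (subst integral_mult_right_zero, subst Bochner_Integration.integral_sum) auto
      also have "(\<Sum>i=1..n. expectation (Y i)) = real n * \<mu>"
        using mean by simp
      finally show ?thesis using n by simp
    qed
    have A_center: "A \<omega> - \<mu> = (1 / real n) * (\<Sum>i=1..n. Z i \<omega>)" for \<omega>
      using n by (simp add: A_def Z_def sum_subtractf field_simps)
    have "indep_vars (\<lambda>_. borel) (\<lambda>i \<omega>. Y i \<omega> - \<mu>) {1..}"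
      using indep_vars_compose2[OF ind, where Y="\<lambda>_ y. y - \<mu>"] by simp
    then have Z_ind: "indep_vars (\<lambda>_. borel) Z {1..n}"
      unfolding Z_def by (rule indep_vars_subset) auto
    have Z_sq: "integrable M (\<lambda>\<omega>. (Z i \<omega>)\<^sup>2)" if "i \<in> {1..n}" for i
      using integrable_square_add[of "Y i" M "\<lambda>_. - \<mu>"] meas[of i] sq[of i] that
      by (simp add: Z_def)
    have Z_mean: "expectation (Z i) = 0" if "i \<in> {1..n}" for i
      using int[of i] mean[of i] that by (simp add: Z_def[abs_def] prob_space)
    note S = expectation_square_sum_indep[OF _ Z_ind Z_sq Z_mean, simplified]
    have A_sq: "integrable M (\<lambda>\<omega>. (A \<omega>)\<^sup>2)"
    proof -
      have "integrable M (\<lambda>\<omega>. (A \<omega> - \<mu>)\<^sup>2)"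
        unfolding A_center power_mult_distrib using S by simp
      then show ?thesis
        using integrable_square_add[of "\<lambda>\<omega>. A \<omega> - \<mu>" M "\<lambda>_. \<mu>"] A_meas by simp
    qed
    have "variance A = (1 / real n)\<^sup>2 * (\<Sum>i=1..n. expectation (\<lambda>\<omega>. (Z i \<omega>)\<^sup>2))"
      unfolding A_mean A_center power_mult_distrib using S by simp
    also have "(\<Sum>i=1..n. expectation (\<lambda>\<omega>. (Z i \<omega>)\<^sup>2)) = real n * \<sigma>"
      using var mean by (simp add: Z_def)
    also have "(1 / real n)\<^sup>2 * (real n * \<sigma>) = \<sigma> * (1 / real n)"
      using n by (simp add: power2_eq_square)
    finally show ?thesis
      using Chebyshev_inequality[OF A_meas A_sq \<epsilon>] unfolding A_mean by (simp add: A_def mult.commute)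
  qed
  then show "\<forall>\<^sub>F n in sequentially. prob {\<omega>\<in>space M. \<epsilon> \<le> \<bar>(1 / real n) * (\<Sum>i=1..n. Y i \<omega>) - \<mu>\<bar>}
        \<le> (\<sigma> / \<epsilon>\<^sup>2) * (1 / real n)"
    by (auto simp: eventually_sequentially)
qed auto


section \<open>Directional derivatives under the expectation\<close>

lemma convex_on_expectation:
  assumes "convex S"
    and "\<And>x. x \<in> space P \<Longrightarrow> convex_on S (\<phi> x)"
    and int: "\<And>\<theta>. \<theta> \<in> S \<Longrightarrow> integrable P (\<lambda>x. \<phi> x \<theta>)"
  shows "convex_on S (\<lambda>\<theta>. \<integral>x. \<phi> x \<theta> \<partial>P)"
proof (rule convex_onI)
  fix t y z assume t: "0 < t" "t < (1::real)" and yz: "y \<in> S" "z \<in> S"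
  have "(1 - t) *\<^sub>R y + t *\<^sub>R z \<in> S"
    using assms(1) yz t by (intro convexD_alt) auto
  then have "(\<integral>x. \<phi> x ((1 - t) *\<^sub>R y + t *\<^sub>R z) \<partial>P) \<le> (\<integral>x. (1 - t) * \<phi> x y + t * \<phi> x z \<partial>P)"
    using yz t by (intro integral_mono int convex_onD[OF assms(2)]) (auto intro!: int)
  also have "\<dots> = (1 - t) * (\<integral>x. \<phi> x y \<partial>P) + t * (\<integral>x. \<phi> x z \<partial>P)"
    using yz int by simp
  finally show "(\<integral>x. \<phi> x ((1 - t) *\<^sub>R y + t *\<^sub>R z) \<partial>P)
      \<le> (1 - t) * (\<integral>x. \<phi> x y \<partial>P) + t * (\<integral>x. \<phi> x z \<partial>P)" .
qed (fact assms(1))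

text \<open>Along a sequence of steps that decreases to zero from some \<open>s\<close>, the slopes of \<open>\<phi> x\<close> converge to the
directional derivative. By monotonicity they lie below the slope at \<open>s\<close> along \<open>u\<close>, and by convexity
above minus the slope at \<open>s\<close> along \<open>- u\<close>. Both are linear combinations of two values of \<open>\<phi> x\<close>, so
the sum of their absolute values is a majorant with the integrability of \<open>\<phi>\<close> itself, and dominated
convergence exchanges limit and expectation.\<close>

lemma
  fixes S :: "'v::real_normed_vector set" and \<phi> :: "'e \<Rightarrow> 'v \<Rightarrow> real"
  assumes S: "open S" "convex S" "z \<in> S"
    and conv: "\<And>x. x \<in> space P \<Longrightarrow> convex_on S (\<phi> x)"
    and int: "\<And>\<theta>. \<theta> \<in> S \<Longrightarrow> integrable P (\<lambda>x. \<phi> x \<theta>)"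
  shows borel_measurable_dir_deriv: "(\<lambda>x. dir_deriv S (\<phi> x) z u) \<in> borel_measurable P"
    and expectation_dir_deriv:
      "(\<integral>x. dir_deriv S (\<phi> x) z u \<partial>P) = dir_deriv S (\<lambda>\<theta>. \<integral>x. \<phi> x \<theta> \<partial>P) z u"
    and square_integrable_dir_deriv:
      "(\<And>\<theta>. \<theta> \<in> S \<Longrightarrow> integrable P (\<lambda>x. (\<phi> x \<theta>)\<^sup>2))
        \<Longrightarrow> integrable P (\<lambda>x. (dir_deriv S (\<phi> x) z u)\<^sup>2)"
proof -
  obtain s where s: "s \<in> steps S z u" "s \<in> steps S z (- u)"
    using obtain_common_step[OF S(1,3)] .
  then have s_pos: "0 < s" by (simp add: steps_def)
  define t where "t k = s / real (Suc k)" for k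
  have t_pos: "0 < t k" and t_le: "t k \<le> s" for k
    using s_pos by (auto simp: t_def field_simps)
  have t_steps: "t k \<in> steps S z u" for k
    using steps_downward[OF S(2,3) s(1) t_pos t_le] .
  have "t \<longlonglongrightarrow> 0"
    unfolding t_def by real_asymp
  then have t_lim: "filterlim t (at_right 0) sequentially"
    by (rule tendsto_imp_filterlim_at_right) (simp add: t_pos)
  have slope_int: "integrable P (\<lambda>x. slope (\<phi> x) z v r)" if "r \<in> steps S z v" for v r
    unfolding slope_def using that S(3) by (intro integrable_divide Bochner_Integration.integrable_diff int) (auto simp: steps_def)
  have lim: "(\<lambda>k. slope (\<phi> x) z u (t k)) \<longlonglongrightarrow> dir_deriv S (\<phi> x) z u" if "x \<in> space P" for x
    using filterlim_compose[OF tendsto_slope_dir_deriv[OF conv[OF that] S(1,3)] t_lim] .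
  show meas: "(\<lambda>x. dir_deriv S (\<phi> x) z u) \<in> borel_measurable P"
    by (rule borel_measurable_LIMSEQ_real[OF lim])
      (auto intro!: borel_measurable_integrable[OF slope_int[OF t_steps]])
  define B where "B x = \<bar>slope (\<phi> x) z u s\<bar> + \<bar>slope (\<phi> x) z (- u) s\<bar>" for x
  have B_int: "integrable P B"
    unfolding B_def using slope_int s by simp
  have slope_B: "\<bar>slope (\<phi> x) z u (t k)\<bar> \<le> B x" if "x \<in> space P" for x k
    using slope_mono[OF conv[OF that] S(3) s(1) t_pos t_le, of k]
      slope_opposite[OF conv[OF that] s(2) t_steps, of k]
    unfolding B_def by linarith
  have "(\<lambda>k. \<integral>x. slope (\<phi> x) z u (t k) \<partial>P) \<longlonglongrightarrow> (\<integral>x. dir_deriv S (\<phi> x) z u \<partial>P)"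
  proof (rule integral_dominated_convergence[where w=B])
    show "AE x in P. (\<lambda>k. slope (\<phi> x) z u (t k)) \<longlonglongrightarrow> dir_deriv S (\<phi> x) z u"
      using lim by (rule AE_I2)
    show "AE x in P. norm (slope (\<phi> x) z u (t k)) \<le> B x" for k
      using slope_B by (auto intro: AE_I2)
    show "(\<lambda>x. slope (\<phi> x) z u (t k)) \<in> borel_measurable P" for k
      using borel_measurable_integrable[OF slope_int[OF t_steps]] .
  qed (fact meas B_int)+
  moreover have "(\<integral>x. slope (\<phi> x) z u (t k) \<partial>P) = slope (\<lambda>\<theta>. \<integral>x. \<phi> x \<theta> \<partial>P) z u (t k)" for k
    using t_steps[of k] S(3) int unfolding slope_def by (simp add: steps_def)
  moreover have "(\<lambda>k. slope (\<lambda>\<theta>. \<integral>x. \<phi> x \<theta> \<partial>P) z u (t k))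
      \<longlonglongrightarrow> dir_deriv S (\<lambda>\<theta>. \<integral>x. \<phi> x \<theta> \<partial>P) z u"
    using filterlim_compose[OF tendsto_slope_dir_deriv[OF convex_on_expectation[OF S(2) conv int] S(1,3)] t_lim] .
  ultimately show "(\<integral>x. dir_deriv S (\<phi> x) z u \<partial>P) = dir_deriv S (\<lambda>\<theta>. \<integral>x. \<phi> x \<theta> \<partial>P) z u"
    using LIMSEQ_unique by simp
  assume sq: "\<And>\<theta>. \<theta> \<in> S \<Longrightarrow> integrable P (\<lambda>x. (\<phi> x \<theta>)\<^sup>2)"
  have slope_sq: "integrable P (\<lambda>x. (slope (\<phi> x) z v r)\<^sup>2)" if "r \<in> steps S z v" for v r
  proof -
    have "integrable P (\<lambda>x. (\<phi> x (z + r *\<^sub>R v) + - \<phi> x z)\<^sup>2)"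
      using that S(3) int sq by (intro integrable_square_add) (auto simp: steps_def)
    then show ?thesis
      by (simp add: slope_def power_divide)
  qed
  have "integrable P (\<lambda>x. (B x)\<^sup>2)"
    unfolding B_def using slope_sq s slope_int
    by (intro integrable_square_add) auto
  moreover have "AE x in P. norm ((dir_deriv S (\<phi> x) z u)\<^sup>2) \<le> norm ((B x)\<^sup>2)"
  proof (rule AE_I2)
    fix x assume x: "x \<in> space P"
    have "\<bar>dir_deriv S (\<phi> x) z u\<bar> \<le> B x"
      using slope_B[OF x] by (intro LIMSEQ_le_const2[OF tendsto_rabs[OF lim[OF x]]]) blast
    then show "norm ((dir_deriv S (\<phi> x) z u)\<^sup>2) \<le> norm ((B x)\<^sup>2)"
      by (simp add: abs_le_square_iff[symmetric])
  qed
  ultimately show "integrable P (\<lambda>x. (dir_deriv S (\<phi> x) z u)\<^sup>2)"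
    using meas by (elim Bochner_Integration.integrable_bound) auto
qed

section \<open>Exact recovery of the minimizer\<close>

theorem theorem5:
  fixes M :: "'w measure" and E P :: "'e measure"
    and X :: "nat \<Rightarrow> 'w \<Rightarrow> 'e"
    and \<Theta>0 \<Theta> :: "(real ^ 'd) set"
    and \<phi> :: "'e \<Rightarrow> real ^ 'd \<Rightarrow> real"
    and \<theta>star :: "real ^ 'd"
    and \<theta>hat :: "nat \<Rightarrow> 'w \<Rightarrow> real ^ 'd"
  assumes "prob_space M"
    and "prob_space.indep_vars M (\<lambda>_. E) X {1..}"
    and "\<And>i. i \<ge> 1 \<Longrightarrow> distr M E (X i) = P"
    and "open \<Theta>0" and "convex \<Theta>0"
    and "closed \<Theta>" and "convex \<Theta>" and "\<Theta> \<subseteq> \<Theta>0"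
    and "\<And>\<theta>. \<theta> \<in> \<Theta>0 \<Longrightarrow> (\<lambda>x. \<phi> x \<theta>) \<in> borel_measurable E"
    and "\<And>x. x \<in> space E \<Longrightarrow> convex_on \<Theta>0 (\<phi> x)"
    and "\<And>\<theta>. \<theta> \<in> \<Theta>0 \<Longrightarrow> integrable P (\<lambda>x. \<phi> x \<theta>)"
    and "\<And>\<theta>. is_arg_min (population_risk M X \<phi>) (\<lambda>\<theta>. \<theta> \<in> \<Theta>) \<theta> \<longleftrightarrow> \<theta> = \<theta>star"
    and "\<And>n. n \<ge> 1 \<Longrightarrow> \<theta>hat n \<in> borel_measurable M"
    and "\<And>n \<omega>. n \<ge> 1 \<Longrightarrow> \<omega> \<in> space M \<Longrightarrow> \<theta>hat n \<omega> \<in> \<Theta>"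
    and "AE \<omega> in M. \<forall>\<^sub>F n in sequentially.
           is_arg_min (empirical_risk X \<phi> n \<omega>) (\<lambda>\<theta>. \<theta> \<in> \<Theta>) (\<theta>hat n \<omega>)"
    and "\<And>\<theta>. \<theta> \<in> \<Theta>0 \<Longrightarrow> integrable P (\<lambda>x. (\<phi> x \<theta>)\<^sup>2)"
    and "0 \<in> interior (subdifferential \<Theta>0 (population_risk M X \<phi>) \<theta>star)"
  shows "(\<lambda>n. measure M {\<omega> \<in> space M. \<theta>hat n \<omega> = \<theta>star}) \<longlonglongrightarrow> 1"
proof -
  interpret prob_space M by fact
  have X_meas: "X i \<in> measurable M E" if "i \<ge> 1" for i
    using assms(2) that by (auto simp: indep_vars_def)
  have space_P: "space P = space E" and sets_P: "sets P = sets E"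
    using assms(3)[of 1] by auto
  have transfer: "(\<integral>\<omega>. h (X i \<omega>) \<partial>M) = (\<integral>x. h x \<partial>P)"
    if "i \<ge> 1" "h \<in> borel_measurable E" for h :: "'e \<Rightarrow> real" and i
    using integral_distr[OF X_meas[OF that(1)] that(2)] assms(3)[OF that(1)] by simp
  have transfer_integrable: "integrable M (\<lambda>\<omega>. h (X i \<omega>))"
    if "i \<ge> 1" "h \<in> borel_measurable E" "integrable P h" for h :: "'e \<Rightarrow> real" and i
    using integrable_distr_eq[OF X_meas[OF that(1)] that(2)] assms(3)[OF that(1)] that(3) by simp
  have star: "\<theta>star \<in> \<Theta>"
    using assms(12) unfolding is_arg_min_def by blast
  then have star0: "\<theta>star \<in> \<Theta>0" using assms(8) by blast
  have conv: "convex_on \<Theta>0 (\<phi> x)" if "x \<in> space P" for x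
    using assms(10) that by (simp add: space_P)
  define D where "D u x = dir_deriv \<Theta>0 (\<phi> x) \<theta>star u" for u x
  define \<mu> where "\<mu> u = (\<integral>x. D u x \<partial>P)" for u
  have D_meas: "D u \<in> borel_measurable E" for u
    using borel_measurable_dir_deriv[OF assms(4,5) star0 conv assms(11), of u]
    unfolding D_def by (simp add: measurable_cong_sets[OF sets_P refl])
  have D_sq: "integrable P (\<lambda>x. (D u x)\<^sup>2)" for u
    using square_integrable_dir_deriv[OF assms(4,5) star0 conv assms(11) assms(16)]
    unfolding D_def by blast
  \<comment> \<open>Sharpness of the population risk, expressed through the means of the derivatives.\<close>
  obtain c where c: "0 < c" "\<And>u. c * norm u \<le> \<mu> u"
  proof -
    have eq: "population_risk M X \<phi> \<theta> = (\<integral>x. \<phi> x \<theta> \<partial>P)" if "\<theta> \<in> \<Theta>0" for \<theta>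
      unfolding population_risk_def using transfer[of 1] assms(9)[OF that] by simp
    have "0 \<in> interior (subdifferential \<Theta>0 (\<lambda>\<theta>. \<integral>x. \<phi> x \<theta> \<partial>P) \<theta>star)"
      using assms(17) star0 by (simp add: subdifferential_def eq cong: ball_cong)
    then obtain c where "0 < c"
      "\<And>u. c * norm u \<le> dir_deriv \<Theta>0 (\<lambda>\<theta>. \<integral>x. \<phi> x \<theta> \<partial>P) \<theta>star u"
      using dir_deriv_linear_growth[OF assms(4) star0] by metis
    moreover have "\<mu> u = dir_deriv \<Theta>0 (\<lambda>\<theta>. \<integral>x. \<phi> x \<theta> \<partial>P) \<theta>star u" for u
      unfolding \<mu>_def D_def by (rule expectation_dir_deriv[OF assms(4,5) star0 conv assms(11)])
    ultimately show ?thesis using that by simp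
  qed
  \<comment> \<open>The slack 1 leaves room for the sampling error at the basis vectors.\<close>
  define C where "C = (\<Sum>b\<in>(Basis::(real ^ 'd) set). \<bar>\<mu> b\<bar> + \<bar>\<mu> (- b)\<bar>) + 1"
  have C: "0 \<le> C" unfolding C_def by (intro add_nonneg_nonneg sum_nonneg) auto
  have C_bound: "\<mu> b + 1 \<le> C \<and> \<mu> (- b) + 1 \<le> C" if "b \<in> Basis" for b
    using member_le_sum[OF that, of "\<lambda>b. \<bar>\<mu> b\<bar> + \<bar>\<mu> (- b)\<bar>"] unfolding C_def by auto
  obtain V :: "(real ^ 'd) set" where V: "finite V" "V \<subseteq> sphere 0 1"
    and net: "\<And>g u. sublinear g \<Longrightarrow> (\<And>v. v \<in> V \<Longrightarrow> c / 2 \<le> g v)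
      \<Longrightarrow> (\<And>b. b \<in> Basis \<Longrightarrow> g b \<le> C \<and> g (- b) \<le> C) \<Longrightarrow> u \<noteq> 0 \<Longrightarrow> 0 < g u"
    using sublinear_positive_net[OF half_gt_zero[OF c(1)] C] by blast
  define W where "W = V \<union> Basis \<union> uminus ` (Basis :: (real ^ 'd) set)"
  have W: "finite W" using V by (simp add: W_def)
  \<comment> \<open>Accuracy that keeps \<open>G\<close> above \<open>c / 2\<close> on the net, where its mean is at least \<open>c\<close>,
    and below \<open>C\<close> at the basis vectors.\<close>
  define \<epsilon> where "\<epsilon> = min 1 (c / 2)"
  have \<epsilon>: "0 < \<epsilon>" "\<epsilon> \<le> 1" "\<epsilon> \<le> c / 2" using c by (auto simp: \<epsilon>_def)
  define G where "G n \<omega> u = (1 / real n) * (\<Sum>i=1..n. D u (X i \<omega>))" for n \<omega> u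
  define bad where "bad n = (\<Union>u\<in>W. {\<omega>\<in>space M. \<epsilon> \<le> \<bar>G n \<omega> u - \<mu> u\<bar>})" for n
  define wrong where "wrong n = {\<omega> \<in> space M. \<theta>hat n \<omega> \<noteq> \<theta>star}" for n
  have DX_meas: "(\<lambda>\<omega>. D u (X i \<omega>)) \<in> borel_measurable M" if "i \<ge> 1" for i u
    using measurable_compose[OF X_meas[OF that] D_meas] .
  have G_meas[measurable]: "(\<lambda>\<omega>. G n \<omega> u) \<in> borel_measurable M" for n u
    unfolding G_def using DX_meas by (intro borel_measurable_times borel_measurable_sum) auto
  have bad_meas[measurable]: "bad n \<in> events" for n
    unfolding bad_def by (intro sets.finite_UN W) measurable
  have wrong_meas: "wrong n \<in> events" if "n \<ge> 1" for n
    using assms(13)[OF that] unfolding wrong_def by measurable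

  have "(\<lambda>n. prob {\<omega>\<in>space M. \<epsilon> \<le> \<bar>G n \<omega> u - \<mu> u\<bar>}) \<longlonglongrightarrow> 0" for u
    unfolding G_def
  proof (rule weak_law_of_large_numbers)
    show "indep_vars (\<lambda>_. borel) (\<lambda>i \<omega>. D u (X i \<omega>)) {1..}"
      using D_meas by (intro indep_vars_compose2[OF assms(2)])
    show "integrable M (\<lambda>\<omega>. (D u (X i \<omega>))\<^sup>2)" if "i \<ge> 1" for i
      using D_meas D_sq that by (intro transfer_integrable) auto
    show mean: "expectation (\<lambda>\<omega>. D u (X i \<omega>)) = \<mu> u" if "i \<ge> 1" for i
      unfolding \<mu>_def using transfer[OF that D_meas] .
    show "variance (\<lambda>\<omega>. D u (X i \<omega>)) = (\<integral>x. (D u x - \<mu> u)\<^sup>2 \<partial>P)" if "i \<ge> 1" for i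
      unfolding mean[OF that] using D_meas that by (intro transfer) auto
  qed (rule \<epsilon>(1))
  then have sum_lim: "(\<lambda>n. \<Sum>u\<in>W. prob {\<omega>\<in>space M. \<epsilon> \<le> \<bar>G n \<omega> u - \<mu> u\<bar>}) \<longlonglongrightarrow> 0"
    by (intro tendsto_null_sum)
  have "prob (bad n) \<le> (\<Sum>u\<in>W. prob {\<omega>\<in>space M. \<epsilon> \<le> \<bar>G n \<omega> u - \<mu> u\<bar>})" for n
    unfolding bad_def using W by (intro finite_measure_subadditive_finite) auto
  then have bad_lim: "(\<lambda>n. prob (bad n)) \<longlonglongrightarrow> 0"
    by (intro tendsto_sandwich[OF _ _ tendsto_const sum_lim] always_eventually) auto

  \<comment> \<open>Off the bad event, sharpness of the empirical risk leaves no other minimizer.\<close>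
  have exact: "\<theta>hat n \<omega> = \<theta>star"
    if n: "n \<ge> 1" and \<omega>: "\<omega> \<in> space M" "\<omega> \<notin> bad n"
      and min: "is_arg_min (empirical_risk X \<phi> n \<omega>) (\<lambda>\<theta>. \<theta> \<in> \<Theta>) (\<theta>hat n \<omega>)" for n \<omega>
  proof (rule ccontr)
    assume "\<theta>hat n \<omega> \<noteq> \<theta>star"
    then have u: "\<theta>hat n \<omega> - \<theta>star \<noteq> 0" by simp
    have X_conv: "convex_on \<Theta>0 (\<phi> (X i \<omega>))" if "i \<in> {1..n}" for i
      using assms(10) measurable_space[OF X_meas \<omega>(1)] that by simp
    have sub: "sublinear (G n \<omega>)"
    proof -
      have D_sub: "sublinear (\<lambda>u. D u (X i \<omega>))" if "i \<in> {1..n}" for i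
        unfolding D_def using sublinear_dir_deriv[OF X_conv[OF that] assms(4) star0] .
      have "(\<Sum>i=1..n. D (u + v) (X i \<omega>)) \<le> (\<Sum>i=1..n. D u (X i \<omega>)) + (\<Sum>i=1..n. D v (X i \<omega>))" for u v
        unfolding sum.distrib[symmetric] using D_sub by (intro sum_mono) (auto simp: sublinear_def)
      then have "G n \<omega> (u + v) \<le> G n \<omega> u + G n \<omega> v" for u v
        unfolding G_def distrib_left[symmetric] by (intro mult_left_mono) auto
      moreover have "G n \<omega> (a *\<^sub>R u) = a * G n \<omega> u" if "0 < a" for a u
        using D_sub that unfolding G_def sublinear_def by (simp add: sum_distrib_left)
      ultimately show ?thesis by (simp add: sublinear_def)
    qed
    have close: "\<bar>G n \<omega> u - \<mu> u\<bar> < \<epsilon>" if "u \<in> W" for u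
      using \<omega> that unfolding bad_def by auto
    have "c / 2 \<le> G n \<omega> v" if "v \<in> V" for v
    proof -
      have "v \<in> W" "norm v = 1" using that V by (auto simp: W_def)
      then show ?thesis
        using close[of v] c(2)[of v] \<open>\<epsilon> \<le> c / 2\<close> by simp
    qed
    moreover have "G n \<omega> b \<le> C \<and> G n \<omega> (- b) \<le> C" if "b \<in> Basis" for b
    proof -
      have "b \<in> W" "- b \<in> W" using that by (auto simp: W_def)
      then show ?thesis
        using close[of b] close[of "- b"] C_bound[OF that] \<epsilon>(2) by linarith
    qed
    ultimately have "0 < G n \<omega> (\<theta>hat n \<omega> - \<theta>star)"
      using net[OF sub _ _ u] by blast
    also have "\<dots> \<le> (1 / real n) * (\<Sum>i=1..n. \<phi> (X i \<omega>) (\<theta>hat n \<omega>) - \<phi> (X i \<omega>) \<theta>star)"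
      unfolding G_def D_def using assms(8) assms(14)[OF n \<omega>(1)]
      by (intro mult_left_mono sum_mono dir_deriv_le_increment X_conv assms(4) star0) auto
    also have "\<dots> = empirical_risk X \<phi> n \<omega> (\<theta>hat n \<omega>) - empirical_risk X \<phi> n \<omega> \<theta>star"
      by (simp add: empirical_risk_def sum_subtractf right_diff_distrib)
    finally show False
      using min star unfolding is_arg_min_def by auto
  qed

  \<comment> \<open>The set of sample points where the estimator minimizes the empirical risk need not be
    measurable. The event that a wrong estimate occurs off the bad event is measurable, and almost
    surely it occurs for finitely many indices only, so dominated convergence sends its probability
    to zero. The index is shifted because measurability of the estimator is known from index 1 on.\<close>
  have "(\<lambda>n. \<integral>\<omega>. indicat_real (wrong (Suc n) - bad (Suc n)) \<omega> \<partial>M) \<longlonglongrightarrow> (\<integral>\<omega>. 0 \<partial>M)"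
  proof (rule integral_dominated_convergence[where w="\<lambda>_. 1"])
    show "AE \<omega> in M. (\<lambda>n. indicat_real (wrong (Suc n) - bad (Suc n)) \<omega>) \<longlonglongrightarrow> 0"
      using assms(15) AE_space
    proof eventually_elim
      case (elim \<omega>)
      have "\<forall>\<^sub>F n in sequentially. is_arg_min (empirical_risk X \<phi> (Suc n) \<omega>) (\<lambda>\<theta>. \<theta> \<in> \<Theta>) (\<theta>hat (Suc n) \<omega>)"
        using eventually_compose_filterlim[OF elim(1) filterlim_Suc] .
      then have "\<forall>\<^sub>F n in sequentially. indicat_real (wrong (Suc n) - bad (Suc n)) \<omega> = 0"
      proof eventually_elim
        case (elim n)
        then show ?case
          using exact[of "Suc n" \<omega>] \<open>\<omega> \<in> space M\<close> by (auto simp: wrong_def indicator_def)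
      qed
      then show ?case by (rule tendsto_eventually)
    qed
  qed (use wrong_meas bad_meas in \<open>auto simp: indicator_def\<close>)
  then have diff_lim: "(\<lambda>n. prob (wrong (Suc n) - bad (Suc n))) \<longlonglongrightarrow> 0"
    using wrong_meas by (simp add: Int_absorb2 sets.sets_into_space)
  have "(\<lambda>n. prob (wrong (Suc n))) \<longlonglongrightarrow> 0"
  proof (rule tendsto_sandwich[OF _ _ tendsto_const])
    show "(\<lambda>n. prob (wrong (Suc n) - bad (Suc n)) + prob (bad (Suc n))) \<longlonglongrightarrow> 0"
      using tendsto_add[OF diff_lim LIMSEQ_Suc[OF bad_lim]] by simp
    have "prob (wrong (Suc n)) \<le> prob (wrong (Suc n) - bad (Suc n)) + prob (bad (Suc n))" for n
    proof -
      have "prob (wrong (Suc n)) \<le> prob ((wrong (Suc n) - bad (Suc n)) \<union> bad (Suc n))"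
        using wrong_meas by (intro finite_measure_mono) auto
      also have "\<dots> \<le> prob (wrong (Suc n) - bad (Suc n)) + prob (bad (Suc n))"
        using wrong_meas by (intro measure_Un_le) auto
      finally show ?thesis .
    qed
    then show "\<forall>\<^sub>F n in sequentially. prob (wrong (Suc n))
        \<le> prob (wrong (Suc n) - bad (Suc n)) + prob (bad (Suc n))"
      by simp
  qed auto
  then have "(\<lambda>n. 1 - prob (wrong (Suc n))) \<longlonglongrightarrow> 1"
    using tendsto_diff[OF tendsto_const[of 1]] by (metis diff_zero)
  moreover have "prob {\<omega> \<in> space M. \<theta>hat (Suc n) \<omega> = \<theta>star} = 1 - prob (wrong (Suc n))" for n
  proof -
    have "{\<omega> \<in> space M. \<theta>hat (Suc n) \<omega> = \<theta>star} = space M - wrong (Suc n)"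
      by (auto simp: wrong_def)
    then show ?thesis using prob_compl[OF wrong_meas] by simp
  qed
  ultimately show ?thesis
    by (simp add: LIMSEQ_imp_Suc)
qed

end
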